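(* Let $a>1$, $b>1$, $m>1$ be integers. Let $K(a,b)$ be the complete multipartite graph with $b$ parts, each having $a$ vertices, and let $mK(a,b)$ be the disjoint union of $m$ copies of $K(a,b)$. Then $$\theta(mK(a,b))=\begin{cases}0 & \text{if } a \text{ is even or } mab \text{ is odd},\\ 1 & \text{otherwise}.\end{cases}$$
   Context: All graphs are simple and finite; $N(u)$ denotes the set of vertices adjacent to $u$. Let $G$ be a graph on $n$ vertices and $S$ a set of $n$ (distinct) positive integers. $G$ is $S$-magic if there is a bijection $l:V(G)\to S$ and a constant $\mu'$ such that $\sum_{v\in N(u)}l(v)=\mu'$ for every vertex $u$ of $G$. Let $\eta(S)$ denote the largest element of $S$, and let $i(G)$ be the infimum of $\eta(S)$ over all sets $S$ of $n$ positive integers for which $G$ is $S$-magic. The distance magic index of $G$ is $\theta(G)=i(G)-n$ (it is infinite if $G$ is not $S$-magic for any $S$). *)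

theory Defs
  imports "Graph_Theory.Pair_Digraph" "HOL-Library.Extended_Nat"
begin

text \<open>
  A simple finite graph is a \<^locale>\<open>pair_graph\<close>: a finite loop-free digraph without parallel
  arcs whose set of arcs is symmetric; each edge \<open>{u, v}\<close> is the pair of arcs \<open>(u, v)\<close>, \<open>(v, u)\<close>.
\<close>

definition nbhd :: "'a pair_pre_digraph \<Rightarrow> 'a \<Rightarrow> 'a set" where
  "nbhd G u = {v \<in> pverts G. (u, v) \<in> parcs G}"

definition S_magic :: "'a pair_pre_digraph \<Rightarrow> nat set \<Rightarrow> bool" where
  "S_magic G S \<longleftrightarrow>
     finite S \<and> card S = card (pverts G) \<and> 0 \<notin> S \<and>
     (\<exists>l \<mu>. bij_betw l (pverts G) S \<and> (\<forall>u \<in> pverts G. (\<Sum>v \<in> nbhd G u. l v) = \<mu>))"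

text \<open>The infimum of the empty set of extended naturals is \<open>\<infinity>\<close>.\<close>

definition magic_inf :: "'a pair_pre_digraph \<Rightarrow> enat" where
  "magic_inf G = (INF S \<in> {S. S_magic G S}. enat (Max S))"

text \<open>The subtraction is not truncated (see \<open>card_le_magic_inf\<close>), and \<open>\<infinity> - enat n = \<infinity>\<close>.\<close>

definition distance_magic_index :: "'a pair_pre_digraph \<Rightarrow> enat" where
  "distance_magic_index G = magic_inf G - enat (card (pverts G))"

lemma card_le_magic_inf: "enat (card (pverts G)) \<le> magic_inf G"
  unfolding magic_inf_def
proof (rule INF_greatest)
  fix S :: "nat set"
  assume "S \<in> {S. S_magic G S}"
  then have S: "finite S" "card S = card (pverts G)" "0 \<notin> S"
    by (auto simp: S_magic_def)
  have "x \<in> {1..Max S}" if "x \<in> S" for x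
    using that S by (cases x) auto
  then have "card S \<le> card {1..Max S}"
    by (intro card_mono) auto
  with S show "enat (card (pverts G)) \<le> enat (Max S)" by simp
qed

text \<open>The vertex \<open>(i, j)\<close> is the \<open>j\<close>-th vertex of the \<open>i\<close>-th part.\<close>

definition complete_multipartite :: "nat \<Rightarrow> nat \<Rightarrow> (nat \<times> nat) pair_pre_digraph" where
  "complete_multipartite a b =
     \<lparr>pverts = {0..<b} \<times> {0..<a},
      parcs = {(u, v). u \<in> {0..<b} \<times> {0..<a} \<and> v \<in> {0..<b} \<times> {0..<a} \<and> fst u \<noteq> fst v}\<rparr>"

definition disjoint_copies :: "nat \<Rightarrow> 'a pair_pre_digraph \<Rightarrow> (nat \<times> 'a) pair_pre_digraph" where
  "disjoint_copies m G =
     \<lparr>pverts = {0..<m} \<times> pverts G,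
      parcs = {((k, u), (k, v)) | k u v. k \<in> {0..<m} \<and> (u, v) \<in> parcs G}\<rparr>"

lemma pair_graph_complete_multipartite: "pair_graph (complete_multipartite a b)"
proof -
  have "finite (parcs (complete_multipartite a b))"
    by (rule finite_subset[of _ "({0..<b} \<times> {0..<a}) \<times> ({0..<b} \<times> {0..<a})"])
      (auto simp: complete_multipartite_def)
  then show ?thesis
    by unfold_locales
      (auto simp: complete_multipartite_def symmetric_def sym_def)
qed

lemma pair_graph_disjoint_copies:
  assumes "pair_graph G"
  shows "pair_graph (disjoint_copies m G)"
proof -
  interpret pair_graph G by (rule assms)
  have "parcs (disjoint_copies m G) \<subseteq> ({0..<m} \<times> pverts G) \<times> ({0..<m} \<times> pverts G)"
    by (auto simp: disjoint_copies_def dest: in_arcsD1 in_arcsD2)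
  then have "finite (parcs (disjoint_copies m G))"
    by (rule finite_subset) (simp add: pair_finite_verts)
  then show ?thesis
    by unfold_locales
      (auto simp: disjoint_copies_def symmetric_def sym_def pair_finite_verts
         dest: in_arcsD1 in_arcsD2 arcs_symmetric no_loops')
qed

end

theory Submission
  imports Defs
begin

text \<open>
  In \<open>mK(a, b)\<close> the neighbours of a vertex are the vertices of the other \<open>b - 1\<close> parts of its copy.
  If all neighbourhood sums equal \<open>\<mu>\<close>, then any two parts of one copy have the same label sum \<open>s\<close>,
  and \<open>(b - 1) * s = \<mu>\<close>, so \<open>s\<close> does not depend on the copy either. Hence \<open>mK(a, b)\<close> is \<open>S\<close>-magic
  if and only if the set \<open>S\<close> of positive integers can be arranged in an array with \<open>p = m * b\<close> rows
  and \<open>a\<close> columns in which all rows have the same sum (\<open>S_magic_iff_balanced\<close>).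

  Let \<open>n = p * a\<close>. The only set of \<open>n\<close> positive integers with maximum at most \<open>n\<close> is \<open>{1..n}\<close>. If
  \<open>S = {1..n}\<close>, then the total is \<open>p * s = n * (n + 1) / 2\<close>, that is, \<open>a * (n + 1) = 2 * s\<close>; so \<open>a\<close> is
  even or \<open>n\<close> is odd (\<open>balanced_initial_parity\<close>). In the remaining cases \<open>Max S \<ge> n + 1\<close>.

  For the constructions, two new columns, one increasing and one decreasing, filled with the next
  \<open>2 * p\<close> integers keep the row sums equal (\<open>balanced_add_2\<close>). It remains to find arrays with no
  column and with three columns. For three columns, a second column is chosen such that the sums of
  the first two entries of the rows run through \<open>p\<close> consecutive integers; the third column then
  compensates. If \<open>p\<close> is odd, the entries can be the integers in \<open>{1..3 * p}\<close>; if \<open>p\<close> is even, those in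
  \<open>{1..3 * p + 1}\<close> except the midpoint of \<open>{p + 1..2 * p + 1}\<close>.
\<close>


section \<open>Arrays with prescribed row sums\<close>

text \<open>
  The set \<open>S\<close> can be arranged, without repetition, in an array with \<open>p\<close> rows and \<open>a\<close> columns
  such that row \<open>r\<close> has sum \<open>\<sigma> r\<close>. Rows and columns are numbered from \<open>0\<close>.
\<close>

definition arrangeable :: "nat \<Rightarrow> nat \<Rightarrow> nat set \<Rightarrow> (nat \<Rightarrow> nat) \<Rightarrow> bool" where
  "arrangeable p a S \<sigma> \<longleftrightarrow>
     (\<exists>f. bij_betw f ({0..<p} \<times> {0..<a}) S \<and> (\<forall>r<p. (\<Sum>j = 0..<a. f (r, j)) = \<sigma> r))"

text \<open>The row sums can be made equal; their common value is left open.\<close>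

definition balanced :: "nat \<Rightarrow> nat \<Rightarrow> nat set \<Rightarrow> bool" where
  "balanced p a S \<longleftrightarrow> (\<exists>s. arrangeable p a S (\<lambda>_. s))"

lemma arrangeable_finite: "arrangeable p a S \<sigma> \<Longrightarrow> finite S"
  by (auto simp: arrangeable_def dest: bij_betw_finite)

lemma arrangeable_card: "arrangeable p a S \<sigma> \<Longrightarrow> card S = p * a"
  by (auto simp: arrangeable_def dest!: bij_betw_same_card)

lemma arrangeable_sum:
  assumes "arrangeable p a S \<sigma>"
  shows "\<Sum>S = (\<Sum>r = 0..<p. \<sigma> r)"
proof -
  obtain f where f: "bij_betw f ({0..<p} \<times> {0..<a}) S"
    and sums: "\<And>r. r < p \<Longrightarrow> (\<Sum>j = 0..<a. f (r, j)) = \<sigma> r"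
    using assms by (auto simp: arrangeable_def)
  have "\<Sum>S = (\<Sum>x \<in> {0..<p} \<times> {0..<a}. f x)"
    using sum.reindex_bij_betw[OF f, of "\<lambda>x. x"] by simp
  also have "\<dots> = (\<Sum>r = 0..<p. \<Sum>j = 0..<a. f (r, j))"
    by (simp add: sum.cartesian_product)
  finally show ?thesis
    by (simp add: sums)
qed

lemma arrangeable_no_columns: "arrangeable p 0 {} (\<lambda>_. 0)"
  by (simp add: arrangeable_def bij_betw_def)

lemma arrangeable_cong:
  "arrangeable p a S \<sigma> \<Longrightarrow> (\<And>r. r < p \<Longrightarrow> \<sigma> r = \<tau> r) \<Longrightarrow> arrangeable p a S \<tau>"
  by (simp add: arrangeable_def)

lemma arrangeable_add_column:
  assumes "arrangeable p a S \<sigma>" and g: "bij_betw g {0..<p} T" and "S \<inter> T = {}"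
  shows "arrangeable p (Suc a) (S \<union> T) (\<lambda>r. \<sigma> r + g r)"
proof -
  obtain f where f: "bij_betw f ({0..<p} \<times> {0..<a}) S"
    and sums: "\<And>r. r < p \<Longrightarrow> (\<Sum>j = 0..<a. f (r, j)) = \<sigma> r"
    using assms(1) by (auto simp: arrangeable_def)
  define h where "h = (\<lambda>x. if snd x < a then f x else g (fst x))"
  have "bij_betw h ({0..<p} \<times> {0..<a}) S"
    using f by (rule bij_betw_cong[THEN iffD1, rotated]) (auto simp: h_def)
  moreover have "bij_betw (\<lambda>x. g (fst x)) ({0..<p} \<times> {a}) T"
    using g by (force simp: bij_betw_def inj_on_def image_def)
  then have "bij_betw h ({0..<p} \<times> {a}) T"
    by (rule bij_betw_cong[THEN iffD1, rotated]) (auto simp: h_def)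
  ultimately have "bij_betw h ({0..<p} \<times> {0..<a} \<union> {0..<p} \<times> {a}) (S \<union> T)"
    using assms(3) by (rule bij_betw_combine)
  moreover have "{0..<p} \<times> {0..<a} \<union> {0..<p} \<times> {a} = {0..<p} \<times> {0..<Suc a}"
    by auto
  moreover have "(\<Sum>j = 0..<Suc a. h (r, j)) = \<sigma> r + g r" if "r < p" for r
    using sums[OF that] by (simp add: h_def)
  ultimately show ?thesis
    unfolding arrangeable_def by auto
qed

lemma bij_betw_of_inj_on_card:
  assumes "inj_on f A" and "f ` A \<subseteq> B" and "finite B" and "card A = card B"
  shows "bij_betw f A B"
  using assms by (simp add: bij_betw_def card_image card_subset_eq)

lemma balanced_add_2:
  assumes "balanced p a S" and "S \<subseteq> {..N}"
  shows "balanced p (a + 2) (S \<union> {N + 1..N + 2 * p})"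
proof -
  obtain s where s: "arrangeable p a S (\<lambda>_. s)"
    using assms(1) by (auto simp: balanced_def)
  have up: "bij_betw (\<lambda>r. N + 1 + r) {0..<p} {N + 1..N + p}"
    by (rule bij_betw_of_inj_on_card) (auto simp: inj_on_def)
  have down: "bij_betw (\<lambda>r. N + 2 * p - r) {0..<p} {N + p + 1..N + 2 * p}"
    by (rule bij_betw_of_inj_on_card) (auto simp: inj_on_def)
  have "arrangeable p (Suc (Suc a)) (S \<union> {N + 1..N + p} \<union> {N + p + 1..N + 2 * p})
          (\<lambda>r. s + (N + 1 + r) + (N + 2 * p - r))"
    using assms(2) by (intro arrangeable_add_column s up down) auto
  moreover have "S \<union> {N + 1..N + p} \<union> {N + p + 1..N + 2 * p} = S \<union> {N + 1..N + 2 * p}"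
    by auto
  ultimately have "arrangeable p (a + 2) (S \<union> {N + 1..N + 2 * p})
                     (\<lambda>r. s + (N + 1 + r) + (N + 2 * p - r))"
    by simp
  then have "arrangeable p (a + 2) (S \<union> {N + 1..N + 2 * p}) (\<lambda>_. s + 2 * N + 2 * p + 1)"
    by (rule arrangeable_cong) simp
  then show ?thesis
    by (auto simp: balanced_def)
qed


section \<open>Arrays with equal row sums\<close>

lemma balanced_even_columns: "balanced p (2 * k) {1..p * (2 * k)}"
proof (induction k)
  case 0
  show ?case
    using arrangeable_no_columns by (auto simp: balanced_def)
next
  case (Suc k)
  have "balanced p (2 * k + 2) ({1..p * (2 * k)} \<union> {p * (2 * k) + 1..p * (2 * k) + 2 * p})"
    using Suc by (rule balanced_add_2) auto
  moreover have "{1..p * (2 * k)} \<union> {p * (2 * k) + 1..p * (2 * k) + 2 * p} = {1..p * (2 * Suc k)}"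
    by (auto simp: algebra_simps)
  ultimately show ?case by simp
qed

lemma balanced_3_odd_rows:
  assumes "odd p"
  shows "balanced p 3 {1..3 * p}"
proof -
  obtain q where p: "p = 2 * q + 1"
    using assms by (auto elim: oddE)
  \<comment> \<open>The sums \<open>r + B r\<close> are \<open>q, q + 2, \<dots>, 3 * q\<close> for \<open>r \<le> q\<close> and \<open>q + 1, q + 3, \<dots>, 3 * q - 1\<close> for
     \<open>r > q\<close>.\<close>
  define B where "B r = (if r \<le> q then r + q else r - q - 1)" for r
  have c1: "bij_betw (\<lambda>r. r + 1) {0..<p} {1..p}"
    by (rule bij_betw_of_inj_on_card) (auto simp: inj_on_def)
  have c2: "bij_betw (\<lambda>r. p + 1 + B r) {0..<p} {p + 1..2 * p}"
    by (rule bij_betw_of_inj_on_card) (auto simp: inj_on_def B_def p split: if_splits)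
  have "inj_on (\<lambda>r. 2 * p + 1 + (3 * q - (r + B r))) {0..<p}"
    by (rule inj_onI) (simp add: B_def p split: if_splits; presburger)
  then have c3: "bij_betw (\<lambda>r. 2 * p + 1 + (3 * q - (r + B r))) {0..<p} {2 * p + 1..3 * p}"
    by (rule bij_betw_of_inj_on_card) (auto simp: B_def p)
  have "arrangeable p (Suc (Suc (Suc 0))) ({} \<union> {1..p} \<union> {p + 1..2 * p} \<union> {2 * p + 1..3 * p})
          (\<lambda>r. 0 + (r + 1) + (p + 1 + B r) + (2 * p + 1 + (3 * q - (r + B r))))"
    by (intro arrangeable_add_column arrangeable_no_columns c1 c2 c3) auto
  moreover have "{} \<union> {1..p} \<union> {p + 1..2 * p} \<union> {2 * p + 1..3 * p} = {1..3 * p}"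
    by auto
  moreover have "0 + (r + 1) + (p + 1 + B r) + (2 * p + 1 + (3 * q - (r + B r))) = 3 * p + 3 * q + 3"
    if "r < p" for r
    using that by (auto simp: B_def p)
  ultimately have "arrangeable p (Suc (Suc (Suc 0))) {1..3 * p} (\<lambda>_. 3 * p + 3 * q + 3)"
    by (metis (no_types, lifting) arrangeable_cong)
  then show ?thesis
    by (auto simp: balanced_def numeral_3_eq_3)
qed

text \<open>
  Since \<open>p\<close> must divide the total, the number omitted from \<open>{1..3 * p + 1}\<close> has to be congruent to
  \<open>p div 2 + 1\<close> modulo \<open>p\<close>.
\<close>

lemma balanced_3_even_rows:
  assumes "even p"
  shows "balanced p 3 ({1..3 * p + 1} - {p + p div 2 + 1})"
proof -
  obtain q where p: "p = 2 * q"
    using assms by (auto elim: evenE)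
  \<comment> \<open>The sums \<open>r + B r\<close> are \<open>q + 1, q + 3, \<dots>, 3 * q - 1\<close> for \<open>r < q\<close> and \<open>q, q + 2, \<dots>, 3 * q - 2\<close> for
     \<open>r \<ge> q\<close>; the value \<open>q\<close> is not attained by \<open>B\<close>.\<close>
  define B where "B r = (if r < q then r + q + 1 else r - q)" for r
  have c1: "bij_betw (\<lambda>r. r + 1) {0..<p} {1..p}"
    by (rule bij_betw_of_inj_on_card) (auto simp: inj_on_def)
  have c2: "bij_betw (\<lambda>r. p + 1 + B r) {0..<p} ({p + 1..2 * p + 1} - {p + q + 1})"
    by (rule bij_betw_of_inj_on_card) (auto simp: inj_on_def B_def p split: if_splits)
  have "inj_on (\<lambda>r. 2 * p + 2 + (3 * q - 1 - (r + B r))) {0..<p}"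
    by (rule inj_onI) (simp add: B_def p split: if_splits; presburger)
  then have c3: "bij_betw (\<lambda>r. 2 * p + 2 + (3 * q - 1 - (r + B r))) {0..<p} {2 * p + 2..3 * p + 1}"
    by (rule bij_betw_of_inj_on_card) (auto simp: B_def p)
  let ?U = "{} \<union> {1..p} \<union> ({p + 1..2 * p + 1} - {p + q + 1}) \<union> {2 * p + 2..3 * p + 1}"
  have "arrangeable p (Suc (Suc (Suc 0))) ?U
          (\<lambda>r. 0 + (r + 1) + (p + 1 + B r) + (2 * p + 2 + (3 * q - 1 - (r + B r))))"
    by (intro arrangeable_add_column arrangeable_no_columns c1 c2 c3) auto
  moreover have "?U = {1..3 * p + 1} - {p + p div 2 + 1}"
    by (auto simp: p)
  moreover have "0 + (r + 1) + (p + 1 + B r) + (2 * p + 2 + (3 * q - 1 - (r + B r))) = 3 * p + 3 * q + 3"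
    if "r < p" for r
    using that by (auto simp: B_def p)
  ultimately have "arrangeable p (Suc (Suc (Suc 0))) ({1..3 * p + 1} - {p + p div 2 + 1}) (\<lambda>_. 3 * p + 3 * q + 3)"
    by (metis (no_types, lifting) arrangeable_cong)
  then show ?thesis
    by (auto simp: balanced_def numeral_3_eq_3)
qed

lemma balanced_odd_columns_odd_rows:
  assumes "odd p"
  shows "balanced p (2 * k + 3) {1..p * (2 * k + 3)}"
proof (induction k)
  case 0
  show ?case
    using balanced_3_odd_rows[OF assms] by (simp add: mult.commute)
next
  case (Suc k)
  let ?N = "p * (2 * k + 3)"
  have "balanced p (2 * k + 3 + 2) ({1..?N} \<union> {?N + 1..?N + 2 * p})"
    using Suc by (rule balanced_add_2) auto
  moreover have "{1..?N} \<union> {?N + 1..?N + 2 * p} = {1..p * (2 * Suc k + 3)}"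
    by (auto simp: algebra_simps)
  moreover have "2 * k + 3 + 2 = 2 * Suc k + 3" by simp
  ultimately show ?case by metis
qed

lemma balanced_odd_columns_even_rows:
  assumes "even p"
  shows "balanced p (2 * k + 3) ({1..p * (2 * k + 3) + 1} - {p + p div 2 + 1})"
proof (induction k)
  case 0
  show ?case
    using balanced_3_even_rows[OF assms] by (simp add: mult.commute)
next
  case (Suc k)
  let ?N = "p * (2 * k + 3) + 1" and ?x = "p + p div 2 + 1"
  have "balanced p (2 * k + 3 + 2) ({1..?N} - {?x} \<union> {?N + 1..?N + 2 * p})"
    using Suc by (rule balanced_add_2) auto
  moreover have "?x \<le> ?N"
    by (auto simp: algebra_simps)
  then have "{1..?N} - {?x} \<union> {?N + 1..?N + 2 * p} = {1..p * (2 * Suc k + 3) + 1} - {?x}"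
    by (auto simp: algebra_simps)
  moreover have "2 * k + 3 + 2 = 2 * Suc k + 3" by simp
  ultimately show ?case by metis
qed

lemma balanced_initial_parity:
  assumes "balanced p a {1..p * a}" and "p > 0"
  shows "even a \<or> odd (p * a)"
proof -
  obtain s where "arrangeable p a {1..p * a} (\<lambda>_. s)"
    using assms(1) by (auto simp: balanced_def)
  then have "\<Sum>{1..p * a} = p * s"
    using arrangeable_sum by fastforce
  moreover have "2 * \<Sum>{1..p * a} = p * a * (p * a + 1)"
    using double_gauss_sum_from_Suc_0[of "p * a", where ?'a = nat] by simp
  ultimately have "p * (a * (p * a + 1)) = p * (2 * s)"
    by (simp add: algebra_simps)
  then have "a * (p * a + 1) = 2 * s"
    using assms(2) by simp
  then have "even (a * (p * a + 1))"
    by simp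
  then show ?thesis by auto
qed


section \<open>Magic labellings of copies of a complete multipartite graph\<close>

abbreviation mK :: "nat \<Rightarrow> nat \<Rightarrow> nat \<Rightarrow> (nat \<times> nat \<times> nat) pair_pre_digraph" where
  "mK m a b \<equiv> disjoint_copies m (complete_multipartite a b)"

lemma pverts_mK: "pverts (mK m a b) = {0..<m} \<times> {0..<b} \<times> {0..<a}"
  by (simp add: disjoint_copies_def complete_multipartite_def)

lemma card_pverts_mK: "card (pverts (mK m a b)) = m * b * a"
  by (simp add: pverts_mK card_cartesian_product)

lemma nbhd_sum_mK:
  assumes "k < m" and "i < b" and "j < a"
  shows "(\<Sum>v \<in> nbhd (mK m a b) (k, i, j). l v) =
         (\<Sum>i' \<in> {0..<b} - {i}. \<Sum>j' = 0..<a. l (k, i', j'))"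
proof -
  have "nbhd (mK m a b) (k, i, j) = Pair k ` (({0..<b} - {i}) \<times> {0..<a})"
    using assms by (auto simp: nbhd_def disjoint_copies_def complete_multipartite_def)
  then have "(\<Sum>v \<in> nbhd (mK m a b) (k, i, j). l v) =
             (\<Sum>x \<in> ({0..<b} - {i}) \<times> {0..<a}. l (k, x))"
    by (simp add: sum.reindex inj_on_def)
  then show ?thesis
    by (simp add: sum.cartesian_product)
qed

text \<open>
  The sum over a copy is \<open>\<mu>\<close> plus the sum over any one of its parts, so the \<open>b\<close> parts of a copy have
  the same sum, and this sum is \<open>\<mu> div (b - 1)\<close> in every copy.
\<close>

lemma nbhd_sums_constant_iff:
  fixes l :: "nat \<times> nat \<times> nat \<Rightarrow> nat"
  assumes "a > 0" and "b > 1"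
  shows "(\<exists>\<mu>. \<forall>u \<in> pverts (mK m a b). (\<Sum>v \<in> nbhd (mK m a b) u. l v) = \<mu>) \<longleftrightarrow>
         (\<exists>s. \<forall>k<m. \<forall>i<b. (\<Sum>j = 0..<a. l (k, i, j)) = s)"
proof
  assume "\<exists>\<mu>. \<forall>u \<in> pverts (mK m a b). (\<Sum>v \<in> nbhd (mK m a b) u. l v) = \<mu>"
  then obtain \<mu> where \<mu>: "\<And>k i j. k < m \<Longrightarrow> i < b \<Longrightarrow> j < a \<Longrightarrow>
      (\<Sum>v \<in> nbhd (mK m a b) (k, i, j). l v) = \<mu>"
    by (auto simp: pverts_mK)
  define P where "P k i = (\<Sum>j = 0..<a. l (k, i, j))" for k i
  have total: "(\<Sum>i' = 0..<b. P k i') = \<mu> + P k i" if "k < m" "i < b" for k i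
  proof -
    have "(\<Sum>i' \<in> {0..<b} - {i}. P k i') = \<mu>"
      using \<mu>[OF that assms(1)] nbhd_sum_mK[OF that assms(1), of l] by (simp add: P_def)
    then show ?thesis
      using sum.remove[of "{0..<b}" i "P k"] that by simp
  qed
  have "P k i = \<mu> div (b - 1)" if "k < m" "i < b" for k i
  proof -
    have "P k i' = P k i" if "i' < b" for i'
      using total[OF \<open>k < m\<close> that] total[OF \<open>k < m\<close> \<open>i < b\<close>] by simp
    then have "b * P k i = \<mu> + P k i"
      using total[OF that] by simp
    then have "(b - 1) * P k i = \<mu>"
      by (simp add: algebra_simps)
    then show ?thesis
      using assms(2) by auto
  qed
  then show "\<exists>s. \<forall>k<m. \<forall>i<b. (\<Sum>j = 0..<a. l (k, i, j)) = s"
    by (auto simp: P_def)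
next
  assume "\<exists>s. \<forall>k<m. \<forall>i<b. (\<Sum>j = 0..<a. l (k, i, j)) = s"
  then obtain s where s: "\<And>k i. k < m \<Longrightarrow> i < b \<Longrightarrow> (\<Sum>j = 0..<a. l (k, i, j)) = s"
    by auto
  have "(\<Sum>v \<in> nbhd (mK m a b) u. l v) = (b - 1) * s" if "u \<in> pverts (mK m a b)" for u
  proof -
    obtain k i j where u: "u = (k, i, j)" and less: "k < m" "i < b" "j < a"
      using \<open>u \<in> pverts (mK m a b)\<close> by (auto simp: pverts_mK)
    have "(\<Sum>v \<in> nbhd (mK m a b) u. l v) = (\<Sum>i' \<in> {0..<b} - {i}. s)"
      unfolding u nbhd_sum_mK[OF less] by (rule sum.cong) (auto simp: s less)
    then show ?thesis
      using less by simp
  qed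
  then show "\<exists>\<mu>. \<forall>u \<in> pverts (mK m a b). (\<Sum>v \<in> nbhd (mK m a b) u. l v) = \<mu>"
    by blast
qed

lemma part_number_less:
  fixes i b k m :: nat
  assumes "k < m" and "i < b"
  shows "k * b + i < m * b"
proof -
  have "k * b + i < Suc k * b"
    using assms(2) by simp
  also have "\<dots> \<le> m * b"
    using assms(1) by (intro mult_right_mono) auto
  finally show ?thesis .
qed

text \<open>Part \<open>i\<close> of copy \<open>k\<close> becomes row \<open>k * b + i\<close> of the array.\<close>

lemma bij_betw_part_number:
  fixes a b m :: nat
  assumes "b > 0"
  shows "bij_betw (\<lambda>(k, i, j). (k * b + i, j))
           ({0..<m} \<times> {0..<b} \<times> {0..<a}) ({0..<m * b} \<times> {0..<a})" (is ?to_row)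
    and "bij_betw (\<lambda>(r, j). (r div b, r mod b, j))
           ({0..<m * b} \<times> {0..<a}) ({0..<m} \<times> {0..<b} \<times> {0..<a})" (is ?from_row)
proof -
  show ?to_row
    by (rule bij_betw_byWitness[where f' = "\<lambda>(r, j). (r div b, r mod b, j)"])
      (use assms in \<open>auto simp: part_number_less less_mult_imp_div_less\<close>)
  show ?from_row
    by (rule bij_betw_byWitness[where f' = "\<lambda>(k, i, j). (k * b + i, j)"])
      (use assms in \<open>auto simp: part_number_less less_mult_imp_div_less\<close>)
qed

lemma S_magic_iff_balanced:
  assumes "a > 0" and "b > 1"
  shows "S_magic (mK m a b) S \<longleftrightarrow> 0 \<notin> S \<and> balanced (m * b) a S"
proof
  assume magic: "S_magic (mK m a b) S"
  then obtain l where l: "bij_betw l (pverts (mK m a b)) S"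
    and "\<exists>\<mu>. \<forall>u \<in> pverts (mK m a b). (\<Sum>v \<in> nbhd (mK m a b) u. l v) = \<mu>"
    by (auto simp: S_magic_def)
  then obtain s where s: "\<And>k i. k < m \<Longrightarrow> i < b \<Longrightarrow> (\<Sum>j = 0..<a. l (k, i, j)) = s"
    unfolding nbhd_sums_constant_iff[OF assms] by auto
  define \<phi> where "\<phi> = (\<lambda>(r, j :: nat). (r div b, r mod b, j))"
  have "bij_betw \<phi> ({0..<m * b} \<times> {0..<a}) (pverts (mK m a b))"
    unfolding pverts_mK \<phi>_def using assms(2) by (intro bij_betw_part_number(2)) simp
  then have "bij_betw (l \<circ> \<phi>) ({0..<m * b} \<times> {0..<a}) S"
    using l by (rule bij_betw_trans)
  moreover have "(\<Sum>j = 0..<a. (l \<circ> \<phi>) (r, j)) = s" if "r < m * b" for r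
    using s[of "r div b" "r mod b"] that assms by (simp add: \<phi>_def less_mult_imp_div_less)
  ultimately have "balanced (m * b) a S"
    unfolding balanced_def arrangeable_def by blast
  then show "0 \<notin> S \<and> balanced (m * b) a S"
    using magic by (simp add: S_magic_def)
next
  assume S: "0 \<notin> S \<and> balanced (m * b) a S"
  then obtain f s where arr: "arrangeable (m * b) a S (\<lambda>_. s)"
    and f: "bij_betw f ({0..<m * b} \<times> {0..<a}) S"
    and sums: "\<And>r. r < m * b \<Longrightarrow> (\<Sum>j = 0..<a. f (r, j)) = s"
    unfolding balanced_def arrangeable_def by blast
  define l where "l = f \<circ> (\<lambda>(k, i, j). (k * b + i, j))"
  have "bij_betw l (pverts (mK m a b)) S"
    unfolding l_def pverts_mK
    using assms(2) by (intro bij_betw_trans[OF bij_betw_part_number(1) f]) simp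
  moreover have "\<exists>s. \<forall>k<m. \<forall>i<b. (\<Sum>j = 0..<a. l (k, i, j)) = s"
    by (auto simp: l_def sums part_number_less)
  then have "\<exists>\<mu>. \<forall>u \<in> pverts (mK m a b). (\<Sum>v \<in> nbhd (mK m a b) u. l v) = \<mu>"
    by (simp only: nbhd_sums_constant_iff[OF assms])
  ultimately show "S_magic (mK m a b) S"
    using S arrangeable_finite[OF arr] arrangeable_card[OF arr]
    unfolding S_magic_def card_pverts_mK by blast
qed


section \<open>The distance magic index\<close>

lemma magic_inf_le:
  assumes "S_magic G S" and "Max S \<le> N"
  shows "magic_inf G \<le> enat N"
  unfolding magic_inf_def using assms by (intro INF_lower2[of S]) auto

lemma S_magic_Max_ge:
  assumes "S_magic G S" and "\<not> S_magic G {1..card (pverts G)}"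
  shows "card (pverts G) < Max S"
proof (rule ccontr)
  assume le: "\<not> card (pverts G) < Max S"
  have S: "finite S" "card S = card (pverts G)" "0 \<notin> S"
    using assms(1) by (auto simp: S_magic_def)
  have "S \<subseteq> {1..card (pverts G)}"
  proof
    fix x assume "x \<in> S"
    then have "x \<le> Max S" "x > 0"
      using S by (auto intro: gr0I)
    then show "x \<in> {1..card (pverts G)}"
      using le by simp
  qed
  then have "S = {1..card (pverts G)}"
    using S by (simp add: card_subset_eq)
  then show False
    using assms by simp
qed

theorem theorem3p2:
  fixes a b m :: nat
  assumes "a > 1" and "b > 1" and "m > 1"
  shows "distance_magic_index (disjoint_copies m (complete_multipartite a b)) =
           (if even a \<or> odd (m * a * b) then 0 else 1)"
proof -
  let ?p = "m * b" and ?n = "m * b * a"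
  have p: "?p > 0"
    using assms by simp
  note magic_iff = S_magic_iff_balanced[of a b m] and n = card_pverts_mK[of m a b]
  have three: "\<exists>k. a = 2 * k + 3" if "odd a"
    using that assms(1) by presburger
  show ?thesis
  proof (cases "even a \<or> odd (m * a * b)")
    case True
    have "balanced ?p a {1..?n}"
    proof (cases "even a")
      case True
      then show ?thesis
        using balanced_even_columns by (auto elim!: evenE)
    next
      case False
      with \<open>even a \<or> odd (m * a * b)\<close> have "odd ?p" by simp
      with three[OF False] show ?thesis
        using balanced_odd_columns_odd_rows by blast
    qed
    then have "S_magic (mK m a b) {1..?n}"
      using magic_iff assms by simp
    then have "magic_inf (mK m a b) \<le> enat ?n"
      using p assms(1) by (intro magic_inf_le) auto
    then have "magic_inf (mK m a b) = enat ?n"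
      using card_le_magic_inf[of "mK m a b"] n by simp
    then show ?thesis
      using True n by (simp add: distance_magic_index_def zero_enat_def)
  next
    case False
    then have "odd a" "even ?p" by auto
    let ?S = "{1..?n + 1} - {?p + ?p div 2 + 1}"
    have "balanced ?p a ?S"
      using three[OF \<open>odd a\<close>] balanced_odd_columns_even_rows[OF \<open>even ?p\<close>] by blast
    then have magic: "S_magic (mK m a b) ?S"
      using magic_iff assms by simp
    then have "?S \<noteq> {}"
      using p assms(1) n by (auto simp: S_magic_def)
    then have "Max ?S \<le> ?n + 1"
      by (subst Max_le_iff) auto
    with magic have upper: "magic_inf (mK m a b) \<le> enat (?n + 1)"
      by (rule magic_inf_le)
    have "\<not> S_magic (mK m a b) {1..?n}"
      using balanced_initial_parity[of ?p a] \<open>odd a\<close> \<open>even ?p\<close> p magic_iff assms by auto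
    then have "?n < Max S" if "S_magic (mK m a b) S" for S
      using S_magic_Max_ge[OF that] n by simp
    then have "enat (?n + 1) \<le> magic_inf (mK m a b)"
      unfolding magic_inf_def by (intro INF_greatest) (auto simp: Suc_le_eq)
    with upper have "magic_inf (mK m a b) = enat (?n + 1)"
      by (rule antisym)
    then show ?thesis
      using n by (simp only: False if_False) (simp add: distance_magic_index_def one_enat_def)
  qed
qed

end
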